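(* For any pair of twin BSTMs $(T_L,T_R)$ as input, the (non-deterministic) Algorithm EmTg (defined in the context) computes a word belonging to the $\equiv_{\mathrm{mTg}}$-equivalence class encoded by $(T_L,T_R)$; that is, whatever choices are made, the algorithm terminates and its output $u$ satisfies $\mathrm{P}_{\mathrm{mTg}}(u) = (T_L,T_R)$.
   Context: Binary trees are rooted planar binary trees (left and right children distinguished); the $i$-th node of a binary tree is the $i$-th node in its inorder traversal. A binary search tree with multiplicities (BSTM) is a binary tree whose nodes are labelled by pairwise distinct letters of $\mathbb{N}=\{1,2,\dots\}$ forming a binary search tree (left subtree letters strictly smaller, right subtree letters strictly greater) and each of whose nodes also carries a positive integer, its multiplicity. $\mathrm{cont}(T)$ is the function giving for each letter its multiplicity in $T$ ($0$ if absent). A pair $(T_L,T_R)$ of BSTMs is a pair of twin BSTMs if $\mathrm{cont}(T_L)=\mathrm{cont}(T_R)$ and for all $i$: the $i$-th nodes of $T_L$ and $T_R$ have the same multiplicity and, if the $i$-th node of $T_L$ has multiplicity 1 and has a left (resp. right) child, then the $i$-th node of $T_R$ has no left (resp. right) child. Inserting a letter $a$ into a BSTM: if a node has letter $a$, increase its multiplicity by 1; otherwise add a new leaf with letter $a$ and multiplicity 1 in the usual binary search tree position. $\mathrm{P}^{\to}_{\mathrm{lTg}}(w)$ (resp. $\mathrm{P}^{\leftarrow}_{\mathrm{rTg}}(w)$) is obtained from the empty tree by inserting the letters of the word $w$ one by one, reading $w$ left to right (resp. right to left), and $\mathrm{P}_{\mathrm{mTg}}(w)=(\mathrm{P}^{\to}_{\mathrm{lTg}}(w),\mathrm{P}^{\leftarrow}_{\mathrm{rTg}}(w))$.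 Two words are $\equiv_{\mathrm{mTg}}$-congruent iff they have the same $\mathrm{P}_{\mathrm{mTg}}$; the class encoded by $(T_L,T_R)$ is the set of words $w$ with $\mathrm{P}_{\mathrm{mTg}}(w)=(T_L,T_R)$. Algorithm EmTg. Input: $(T_L,T_R)$. Start with $u$ the empty word and $(U_L,U_R)=(T_L,T_R)$. (During the algorithm $U_L$ is a forest, since root nodes are removed from it, and leaves are removed from $U_R$.) While $U_L$ and $U_R$ are not both empty: - If every leaf of $U_R$ has a letter that also labels a node of $U_L$: choose a letter $a$ labelling the root node of a tree in $U_L$ such that $a$ has multiplicity greater than 1 or $a$ labels a leaf of $U_R$; let $m_a$ be the multiplicity of $a$. If $m_a>1$, replace $u$ by $u\,a^{m_a-1}$; otherwise replace $u$ by $ua$ and remove the node labelled $a$ from $U_R$. In both cases remove the node labelled $a$ from $U_L$. - Otherwise: choose a letter $a$ labelling a leaf of $U_R$ and no node of $U_L$; replace $u$ by $ua$ and remove the node labelled $a$ from $U_R$. Return $u$. *)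

theory Defs
  imports "HOL-Library.Tree"
begin

text \<open>
  Words are lists over the alphabet \<open>{1..}\<close> of positive natural numbers.  Nodes of binary search
  trees with multiplicities carry pairs (letter, multiplicity).  In the library's tree type,
  \<open>Leaf\<close> (written \<open>\<langle>\<rangle>\<close>) is the \<^emph>\<open>empty\<close> tree; a leaf in the sense of a node without
  children is \<open>\<langle>\<langle>\<rangle>, x, \<langle>\<rangle>\<rangle>\<close>.
\<close>

type_synonym word = "nat list"
type_synonym mtree = "(nat \<times> nat) tree"

definition letters :: "mtree \<Rightarrow> nat set" where
  "letters T = fst ` set_tree T"

definition bstm :: "mtree \<Rightarrow> bool" where
  "bstm T \<longleftrightarrow> bst (map_tree fst T) \<and> (\<forall>(a, m) \<in> set_tree T. a \<ge> 1 \<and> m \<ge> 1)"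

definition cont :: "mtree \<Rightarrow> nat \<Rightarrow> nat" where
  "cont T a = (case map_of (inorder T) a of None \<Rightarrow> 0 | Some m \<Rightarrow> m)"

text \<open>The nodes in inorder, each one represented by the (nonempty) subtree rooted at it.\<close>

fun inorder_nodes :: "'a tree \<Rightarrow> 'a tree list" where
  "inorder_nodes \<langle>\<rangle> = []"
| "inorder_nodes \<langle>l, x, r\<rangle> = inorder_nodes l @ [\<langle>l, x, r\<rangle>] @ inorder_nodes r"

definition node_mult :: "mtree \<Rightarrow> nat" where
  "node_mult t = snd (value t)"

definition has_left_child :: "'a tree \<Rightarrow> bool" where
  "has_left_child t \<longleftrightarrow> left t \<noteq> \<langle>\<rangle>"

definition has_right_child :: "'a tree \<Rightarrow> bool" where
  "has_right_child t \<longleftrightarrow> right t \<noteq> \<langle>\<rangle>"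

text \<open>Equality of the contents forces both trees to have the same number of nodes, so that
  the indexing into the second list below is within bounds.\<close>

definition twin_bstms :: "mtree \<Rightarrow> mtree \<Rightarrow> bool" where
  "twin_bstms T\<^sub>L T\<^sub>R \<longleftrightarrow>
     bstm T\<^sub>L \<and> bstm T\<^sub>R \<and> cont T\<^sub>L = cont T\<^sub>R \<and>
     (\<forall>i < size T\<^sub>L.
        let x = inorder_nodes T\<^sub>L ! i; y = inorder_nodes T\<^sub>R ! i in
          node_mult x = node_mult y \<and>
          (node_mult x = 1 \<and> has_left_child x \<longrightarrow> \<not> has_left_child y) \<and>
          (node_mult x = 1 \<and> has_right_child x \<longrightarrow> \<not> has_right_child y))"

fun insert_bstm :: "nat \<Rightarrow> mtree \<Rightarrow> mtree" where
  "insert_bstm a \<langle>\<rangle> = \<langle>\<langle>\<rangle>, (a, 1), \<langle>\<rangle>\<rangle>"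
| "insert_bstm a \<langle>l, (b, m), r\<rangle> =
     (if a < b then \<langle>insert_bstm a l, (b, m), r\<rangle>
      else if a > b then \<langle>l, (b, m), insert_bstm a r\<rangle>
      else \<langle>l, (b, m + 1), r\<rangle>)"

definition P_lTg :: "word \<Rightarrow> mtree" where
  "P_lTg w = fold insert_bstm w \<langle>\<rangle>"

definition P_rTg :: "word \<Rightarrow> mtree" where
  "P_rTg w = fold insert_bstm (rev w) \<langle>\<rangle>"

definition P_mTg :: "word \<Rightarrow> mtree \<times> mtree" where
  "P_mTg w = (P_lTg w, P_rTg w)"

text \<open>The congruence class encoded by a pair of trees: a fibre of \<open>P_mTg\<close>, two words being
  congruent iff they have the same image under \<open>P_mTg\<close>.\<close>

definition mTg_class :: "mtree \<Rightarrow> mtree \<Rightarrow> word set" where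
  "mTg_class T\<^sub>L T\<^sub>R = {w \<in> lists {1..}. P_mTg w = (T\<^sub>L, T\<^sub>R)}"

text \<open>A forest is a list of nonempty trees; the order of the trees is immaterial to the
  algorithm, which may choose any root.\<close>

type_synonym forest = "mtree list"

definition forest_of :: "mtree list \<Rightarrow> forest" where
  "forest_of ts = filter (\<lambda>t. t \<noteq> \<langle>\<rangle>) ts"

definition forest_letters :: "forest \<Rightarrow> nat set" where
  "forest_letters F = (\<Union>t \<in> set F. letters t)"

definition leaf_letters :: "mtree \<Rightarrow> nat set" where
  "leaf_letters T = {a. \<exists>m. \<langle>\<langle>\<rangle>, (a, m), \<langle>\<rangle>\<rangle> \<in> set (inorder_nodes T)}"

text \<open>Removal of the leaf labelled by a given letter; only used when there is such a leaf.\<close>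

fun remove_leaf :: "nat \<Rightarrow> mtree \<Rightarrow> mtree" where
  "remove_leaf a \<langle>\<rangle> = \<langle>\<rangle>"
| "remove_leaf a \<langle>l, (b, m), r\<rangle> =
     (if a = b \<and> l = \<langle>\<rangle> \<and> r = \<langle>\<rangle> then \<langle>\<rangle>
      else \<langle>remove_leaf a l, (b, m), remove_leaf a r\<rangle>)"

text \<open>
  Algorithm EmTg as a nondeterministic transition system on states \<open>(u, U\<^sub>L, U\<^sub>R)\<close>.  One step is one
  iteration of the while loop with some admissible choice of the letter \<open>a\<close>.  The first two rules
  are the two subcases (\<open>m\<^sub>a > 1\<close> and \<open>m\<^sub>a = 1\<close>) of the first branch of the loop body.  The premises
  of the third rule imply that the guard of the first branch is false.  Every rule needs
  \<open>U\<^sub>L\<close> or \<open>U\<^sub>R\<close> nonempty, which is the loop condition.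
\<close>

type_synonym EmTg_state = "word \<times> forest \<times> mtree"

inductive EmTg_step :: "EmTg_state \<Rightarrow> EmTg_state \<Rightarrow> bool" where
  multiple:
    "\<lbrakk> U\<^sub>L = ts @ [\<langle>l, (a, m), r\<rangle>] @ ts';
       leaf_letters U\<^sub>R \<subseteq> forest_letters U\<^sub>L;
       m > 1 \<rbrakk> \<Longrightarrow>
     EmTg_step (u, U\<^sub>L, U\<^sub>R)
       (u @ replicate (m - 1) a, ts @ forest_of [l, r] @ ts', U\<^sub>R)"
| simple:
    "\<lbrakk> U\<^sub>L = ts @ [\<langle>l, (a, m), r\<rangle>] @ ts';
       leaf_letters U\<^sub>R \<subseteq> forest_letters U\<^sub>L;
       \<not> m > 1; a \<in> leaf_letters U\<^sub>R \<rbrakk> \<Longrightarrow>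
     EmTg_step (u, U\<^sub>L, U\<^sub>R)
       (u @ [a], ts @ forest_of [l, r] @ ts', remove_leaf a U\<^sub>R)"
| last_occurrence:
    "\<lbrakk> a \<in> leaf_letters U\<^sub>R; a \<notin> forest_letters U\<^sub>L \<rbrakk> \<Longrightarrow>
     EmTg_step (u, U\<^sub>L, U\<^sub>R) (u @ [a], U\<^sub>L, remove_leaf a U\<^sub>R)"

definition EmTg_init :: "mtree \<Rightarrow> mtree \<Rightarrow> EmTg_state" where
  "EmTg_init T\<^sub>L T\<^sub>R = ([], forest_of [T\<^sub>L], T\<^sub>R)"

definition EmTg_reachable :: "mtree \<Rightarrow> mtree \<Rightarrow> EmTg_state \<Rightarrow> bool" where
  "EmTg_reachable T\<^sub>L T\<^sub>R s \<longleftrightarrow> EmTg_step\<^sup>*\<^sup>* (EmTg_init T\<^sub>L T\<^sub>R) s"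

definition EmTg_infinite_run :: "mtree \<Rightarrow> mtree \<Rightarrow> (nat \<Rightarrow> EmTg_state) \<Rightarrow> bool" where
  "EmTg_infinite_run T\<^sub>L T\<^sub>R run \<longleftrightarrow>
     run 0 = EmTg_init T\<^sub>L T\<^sub>R \<and> (\<forall>i. EmTg_step (run i) (run (Suc i)))"

definition EmTg_returns :: "mtree \<Rightarrow> mtree \<Rightarrow> word \<Rightarrow> bool" where
  "EmTg_returns T\<^sub>L T\<^sub>R u \<longleftrightarrow> EmTg_reachable T\<^sub>L T\<^sub>R (u, [], \<langle>\<rangle>)"

end

theory Submission
  imports Defs
begin

text \<open>
  A word inserts to a given search tree as soon as its letters have the right multiplicities and
  the first occurrence of every letter precedes the first occurrences of its descendants. The
  algorithm removes nodes of \<open>T\<^sub>L\<close> from the roots at their first occurrences and nodes of \<open>T\<^sub>R\<close> from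
  the leaves at their last occurrences, so the word has this property for \<open>T\<^sub>L\<close> and its reversal
  has it for \<open>T\<^sub>R\<close>. The twin condition prevents deadlocks: if no root of the forest were eligible,
  two neighbouring roots would be ancestors of each other in \<open>T\<^sub>R\<close>.
\<close>

subsection \<open>Binary search trees with multiplicities\<close>

definition key_bst :: "mtree \<Rightarrow> bool" where
  "key_bst T \<longleftrightarrow> bst (map_tree fst T)"

lemma letters_Leaf [simp]: "letters \<langle>\<rangle> = {}"
  by (simp add: letters_def)

lemma letters_Node [simp]: "letters \<langle>l, (x, m), r\<rangle> = insert x (letters l \<union> letters r)"
  by (auto simp: letters_def)

lemma key_bst_Leaf [simp]: "key_bst \<langle>\<rangle>"
  by (simp add: key_bst_def)

lemma key_bst_Node [simp]:
  "key_bst \<langle>l, (x, m), r\<rangle> \<longleftrightarrow>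
     key_bst l \<and> key_bst r \<and> (\<forall>a\<in>letters l. a < x) \<and> (\<forall>a\<in>letters r. x < a)"
  by (auto simp: key_bst_def letters_def tree.set_map)

lemma letters_eq_set_inorder: "letters T = set (map fst (inorder T))"
  by (simp add: letters_def)

lemma key_bst_iff_sorted: "key_bst T \<longleftrightarrow> sorted_wrt (<) (map fst (inorder T))"
  by (simp add: key_bst_def bst_iff_sorted_wrt_less inorder_map)

lemma key_bst_iff_distinct: "key_bst T \<Longrightarrow> distinct (map fst (inorder T))"
  by (simp add: key_bst_iff_sorted strict_sorted_iff)

lemma cont_notin: "a \<notin> letters T \<Longrightarrow> cont T a = 0"
  by (force simp: cont_def letters_def dest: map_of_SomeD split: option.splits)

lemma cont_eq:
  assumes "key_bst T" "(a, m) \<in> set_tree T"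
  shows "cont T a = m"
  using assms map_of_eq_Some_iff[OF key_bst_iff_distinct[OF assms(1)], of a m]
  by (simp add: cont_def)

lemma bstm_iff: "bstm T \<longleftrightarrow> key_bst T \<and> (\<forall>(a, m)\<in>set_tree T. 1 \<le> a \<and> 1 \<le> m)"
  by (simp add: bstm_def key_bst_def)

lemma bstm_key_bst: "bstm T \<Longrightarrow> key_bst T"
  by (simp add: bstm_iff)

lemma bstm_Node:
  "bstm \<langle>l, (x, m), r\<rangle> \<longleftrightarrow> bstm l \<and> bstm r \<and> 1 \<le> x \<and> 1 \<le> m \<and>
     (\<forall>a\<in>letters l. a < x) \<and> (\<forall>a\<in>letters r. x < a)"
  by (auto simp: bstm_iff)

lemma cont_pos_iff:
  assumes "bstm T"
  shows "0 < cont T a \<longleftrightarrow> a \<in> letters T"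
proof
  assume "a \<in> letters T"
  then obtain m where "(a, m) \<in> set_tree T" by (auto simp: letters_def)
  then show "0 < cont T a"
    using assms cont_eq[OF bstm_key_bst[OF assms]] by (fastforce simp: bstm_def)
qed (use cont_notin in fastforce)

lemma cont_Node:
  assumes "bstm \<langle>l, (x, m), r\<rangle>"
  shows "cont \<langle>l, (x, m), r\<rangle> a = (if a < x then cont l a else if a = x then m else cont r a)"
proof -
  have "map_of (inorder l) a = None" if "a \<ge> x"
    using that assms by (force simp: bstm_Node letters_def map_of_eq_None_iff)
  moreover have "map_of (inorder r) a = None" if "a \<le> x"
    using that assms by (force simp: bstm_Node letters_def map_of_eq_None_iff)
  ultimately show ?thesis
    by (auto simp: cont_def map_add_def split: option.splits)
qed

subsection \<open>The ancestor relation\<close>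

text \<open>Relates letters rather than nodes, so that the relations of different trees over the
  same letters can be compared; strict, with the upper letter first.\<close>

fun ancestor :: "mtree \<Rightarrow> nat \<Rightarrow> nat \<Rightarrow> bool" where
  "ancestor \<langle>\<rangle> a b \<longleftrightarrow> False"
| "ancestor \<langle>l, (x, m), r\<rangle> a b \<longleftrightarrow>
     a = x \<and> b \<in> letters l \<union> letters r \<or> ancestor l a b \<or> ancestor r a b"

lemma ancestor_letters: "ancestor T a b \<Longrightarrow> a \<in> letters T \<and> b \<in> letters T"
  by (induction T a b rule: ancestor.induct) auto

lemma ancestor_asym: "key_bst T \<Longrightarrow> ancestor T a b \<Longrightarrow> \<not> ancestor T b a"
proof (induction T a b rule: ancestor.induct)
  case (2 l x m r a b)
  have "x \<notin> letters l" "x \<notin> letters r" "letters l \<inter> letters r = {}"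
    using "2.prems"(1) by fastforce+
  then show ?case
    using 2 ancestor_letters[of l a b] ancestor_letters[of r a b]
      ancestor_letters[of l b a] ancestor_letters[of r b a] by auto
qed simp

lemma ancestor_irrefl: "key_bst T \<Longrightarrow> \<not> ancestor T a a"
  using ancestor_asym by blast

text \<open>The letters of a subtree form an interval among the letters of a search tree, so
  whatever lies between \<open>a\<close> and a descendant of \<open>a\<close> also hangs below
  \<open>a\<close>.\<close>

lemma ancestor_between:
  assumes "key_bst T" "ancestor T a b" "c \<in> letters T" "a < c \<and> c < b \<or> b < c \<and> c < a"
  shows "ancestor T a c"
  using assms
proof (induction T a b rule: ancestor.induct)
  case (2 l x m r a b)
  then have bst: "key_bst l" "key_bst r" "\<forall>a\<in>letters l. a < x" "\<forall>a\<in>letters r. x < a"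
    by auto
  consider "a = x" "b \<in> letters l \<union> letters r" | "ancestor l a b" | "ancestor r a b"
    using 2 by auto
  then show ?case
  proof cases
    case 1
    then show ?thesis using 2 by auto
  next
    case 2
    then have "c \<in> letters l"
      using bst "2.prems" ancestor_letters[OF 2] by fastforce
    with 2 show ?thesis using "2.IH" bst "2.prems" by auto
  next
    case 3
    then have "c \<in> letters r"
      using bst "2.prems" ancestor_letters[OF 3] by fastforce
    with 3 show ?thesis using "2.IH" bst "2.prems" by auto
  qed
qed simp

text \<open>Bridge from the recursive definition to the list of nodes in which the twin condition is
  phrased.\<close>

lemma ancestor_iff_inorder_nodes:
  "ancestor T a b \<longleftrightarrow>
     (\<exists>l m r. \<langle>l, (a, m), r\<rangle> \<in> set (inorder_nodes T) \<and> b \<in> letters l \<union> letters r)"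
  by (induction T a b rule: ancestor.induct) (simp; blast)+

lemma map_value_inorder_nodes: "map value (inorder_nodes T) = inorder T"
  by (induction T rule: inorder_nodes.induct) auto

section \<open>Leaves and the nodes above them\<close>

lemma leaf_letters_Leaf [simp]: "leaf_letters \<langle>\<rangle> = {}"
  by (simp add: leaf_letters_def)

lemma leaf_letters_Node [simp]:
  "leaf_letters \<langle>l, (x, m), r\<rangle> =
     (if l = \<langle>\<rangle> \<and> r = \<langle>\<rangle> then {x} else leaf_letters l \<union> leaf_letters r)"
  by (auto simp: leaf_letters_def)

lemma leaf_letters_subset: "leaf_letters T \<subseteq> letters T"
  by (induction T) (auto split: if_splits)

lemma leaf_letters_nonempty: "T \<noteq> \<langle>\<rangle> \<Longrightarrow> leaf_letters T \<noteq> {}"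
proof (induction T)
  case (Node l x r)
  then show ?case by (cases x) auto
qed simp

lemma leaf_or_above_leaf:
  "a \<in> letters T \<Longrightarrow> a \<in> leaf_letters T \<or> (\<exists>b\<in>leaf_letters T. ancestor T a b)"
proof (induction T)
  case (Node l x r)
  obtain k m where x: "x = (k, m)" by fastforce
  have "\<exists>b\<in>leaf_letters \<langle>l, x, r\<rangle>. ancestor \<langle>l, x, r\<rangle> k b" if "\<not> (l = \<langle>\<rangle> \<and> r = \<langle>\<rangle>)"
    using that leaf_letters_nonempty[of l] leaf_letters_nonempty[of r]
      leaf_letters_subset[of l] leaf_letters_subset[of r] by (fastforce simp: x)
  then show ?case
    using Node by (fastforce simp: x split: if_splits)
qed simp

subsection \<open>Removing a leaf\<close>

lemma remove_leaf_notin: "a \<notin> leaf_letters T \<Longrightarrow> remove_leaf a T = T"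
  by (induction a T rule: remove_leaf.induct) (auto split: if_splits)

text \<open>\<open>remove_leaf\<close> recurses into both subtrees; in a search tree
  \<open>a\<close> occurs in at most one of them, and the call on a subtree without \<open>a\<close>
  is the identity.\<close>

lemma remove_leaf_Node_cases [consumes 2, case_names root left right]:
  assumes "key_bst \<langle>l, (x, m), r\<rangle>" "a \<in> leaf_letters \<langle>l, (x, m), r\<rangle>"
  obtains "l = \<langle>\<rangle>" "r = \<langle>\<rangle>" "a = x"
  | "a \<in> leaf_letters l" "a \<in> letters l" "a \<notin> letters r" "a \<noteq> x"
      "remove_leaf a \<langle>l, (x, m), r\<rangle> = \<langle>remove_leaf a l, (x, m), r\<rangle>"
  | "a \<in> leaf_letters r" "a \<in> letters r" "a \<notin> letters l" "a \<noteq> x"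
      "remove_leaf a \<langle>l, (x, m), r\<rangle> = \<langle>l, (x, m), remove_leaf a r\<rangle>"
proof -
  have bst: "\<forall>b\<in>letters l. b < x" "\<forall>b\<in>letters r. x < b"
    using assms(1) by auto
  consider "l = \<langle>\<rangle>" "r = \<langle>\<rangle>" "a = x" | "a \<in> leaf_letters l" | "a \<in> leaf_letters r"
    using assms(2) by (auto split: if_splits)
  then show ?thesis
  proof cases
    case 2
    then have "a \<in> letters l" using leaf_letters_subset by blast
    moreover from this have "a < x" "a \<notin> letters r" using bst by fastforce+
    moreover from this have "remove_leaf a r = r"
      using remove_leaf_notin leaf_letters_subset by blast
    ultimately show ?thesis using 2 that(2) by simp
  next
    case 3
    then have "a \<in> letters r" using leaf_letters_subset by blast
    moreover from this have "x < a" "a \<notin> letters l" using bst by fastforce+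
    moreover from this have "remove_leaf a l = l"
      using remove_leaf_notin leaf_letters_subset by blast
    ultimately show ?thesis using 3 that(3) by simp
  qed (use that(1) in simp)
qed

lemma letters_remove_leaf:
  "key_bst T \<Longrightarrow> a \<in> leaf_letters T \<Longrightarrow> letters (remove_leaf a T) = letters T - {a}"
proof (induction a T rule: remove_leaf.induct)
  case (2 a l x m r)
  then have bst: "key_bst l" "key_bst r" by simp_all
  from "2.prems" show ?case
    by (cases rule: remove_leaf_Node_cases) (use "2.IH" bst in auto)
qed simp

lemma letters_remove_leaf_subset: "letters (remove_leaf a T) \<subseteq> letters T"
  by (induction a T rule: remove_leaf.induct) auto

lemma key_bst_remove_leaf: "key_bst T \<Longrightarrow> key_bst (remove_leaf a T)"
proof (induction a T rule: remove_leaf.induct)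
  case (2 a l x m r)
  then show ?case
    using letters_remove_leaf_subset[of a l] letters_remove_leaf_subset[of a r] by auto
qed simp

text \<open>A leaf is above nothing, so its removal only loses the pairs that have it at the lower
  end.\<close>

lemma ancestor_remove_leaf:
  "key_bst T \<Longrightarrow> a \<in> leaf_letters T \<Longrightarrow>
     ancestor (remove_leaf a T) b c \<longleftrightarrow> ancestor T b c \<and> c \<noteq> a"
proof (induction a T rule: remove_leaf.induct)
  case (2 a l x m r)
  then have bst: "key_bst l" "key_bst r" by simp_all
  from "2.prems" show ?case
  proof (cases rule: remove_leaf_Node_cases)
    case left
    then show ?thesis
      using "2.IH"(1) bst ancestor_letters[of r b c] by (auto simp: letters_remove_leaf)
  next
    case right
    then show ?thesis
      using "2.IH"(2) bst ancestor_letters[of l b c] by (auto simp: letters_remove_leaf)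
  qed simp
qed simp

lemma size_remove_leaf: "a \<in> leaf_letters T \<Longrightarrow> size (remove_leaf a T) < size T"
proof (induction a T rule: remove_leaf.induct)
  case (2 a l b m r)
  then show ?case
    using remove_leaf_notin[of a l] remove_leaf_notin[of a r]
    by (cases "a \<in> leaf_letters l"; cases "a \<in> leaf_letters r") (auto split: if_splits)
qed simp

subsection \<open>Words inserting to a given tree\<close>

text \<open>The root never moves and sends smaller and larger letters to its two sides, so the word
  splits into independent insertions.\<close>

lemma fold_insert_bstm_Node:
  "fold insert_bstm w \<langle>l, (x, m), r\<rangle> =
     \<langle>fold insert_bstm (filter (\<lambda>a. a < x) w) l, (x, m + count_list w x),
      fold insert_bstm (filter (\<lambda>a. x < a) w) r\<rangle>"
  by (induction w arbitrary: l m r) auto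

text \<open>Asking this of every occurrence of \<open>b\<close> amounts to asking it of the first
  one. A letter \<open>b\<close> not yet written imposes nothing, so the condition also makes sense
  for unfinished words.\<close>

definition first_occs_ok :: "mtree \<Rightarrow> word \<Rightarrow> bool" where
  "first_occs_ok T w \<longleftrightarrow> (\<forall>a b p s. ancestor T a b \<and> w = p @ b # s \<longrightarrow> a \<in> set p)"

lemma count_list_filter: "count_list (filter P w) a = (if P a then count_list w a else 0)"
  by (induction w) auto

lemma filter_eq_append_ConsE:
  assumes "filter P w = p @ b # s"
  obtains p' s' where "w = p' @ b # s'" "filter P p' = p"
proof -
  have "\<exists>p' s'. w = p' @ b # s' \<and> filter P p' = p"
    using assms
  proof (induction w arbitrary: p)
    case (Cons c w)
    show ?case
    proof (cases "P c")
      case False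
      then obtain p' s' where "w = p' @ b # s'" "filter P p' = p" using Cons by auto
      then show ?thesis using False by (intro exI[of _ "c # p'"] exI[of _ s']) simp
    next
      case True
      show ?thesis
      proof (cases p)
        case Nil
        then show ?thesis using Cons.prems True by (intro exI[of _ "[]"] exI[of _ w]) simp
      next
        case (Cons d p2)
        then obtain p' s' where "w = p' @ b # s'" "filter P p' = p2"
          using Cons.prems Cons.IH True by auto
        then show ?thesis
          using Cons Cons.prems True by (intro exI[of _ "c # p'"] exI[of _ s']) simp
      qed
    qed
  qed simp
  then show ?thesis using that by blast
qed

text \<open>Passage to a subtree once the root letter \<open>x\<close> has been read: a prefix of
  the filtered word lifts to a prefix of \<open>w\<close>, and the ancestor found there survives the
  filter because it differs from \<open>x\<close> and satisfies \<open>P\<close>.\<close>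

lemma first_occs_ok_filter:
  assumes "first_occs_ok T (x # w)" "\<And>a b. ancestor t a b \<Longrightarrow> ancestor T a b \<and> a \<noteq> x \<and> P a"
  shows "first_occs_ok t (filter P w)"
  unfolding first_occs_ok_def
proof (intro allI impI, elim conjE)
  fix a b p s assume a: "ancestor t a b" and "filter P w = p @ b # s"
  from this(2) obtain p' s' where "w = p' @ b # s'" and p: "filter P p' = p"
    by (rule filter_eq_append_ConsE)
  then have "x # w = (x # p') @ b # s'" by simp
  then have "a \<in> set (x # p')"
    using assms a unfolding first_occs_ok_def by blast
  then show "a \<in> set p" using assms(2)[OF a] by (auto simp flip: p)
qed

text \<open>By induction on the tree: the first letter must be the root, and the remaining letters
  split into words for the two subtrees that inherit both conditions.\<close>

lemma fold_insert_bstm_eq: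
  assumes "bstm T" "\<And>a. count_list w a = cont T a" "first_occs_ok T w"
  shows "fold insert_bstm w \<langle>\<rangle> = T"
  using assms
proof (induction T arbitrary: w)
  case Leaf
  then have "set w = {}" by (metis all_not_in_conv cont_notin count_list_0_iff empty_iff letters_Leaf)
  then show ?case by simp
next
  case (Node l k r)
  obtain x m where k: "k = (x, m)" by fastforce
  note [simp] = k
  have bst: "bstm l" "bstm r" "1 \<le> m" "\<forall>a\<in>letters l. a < x" "\<forall>a\<in>letters r. x < a"
    using Node.prems by (auto simp: bstm_Node)
  have cont: "count_list w a = (if a < x then cont l a else if a = x then m else cont r a)" for a
    using Node.prems cont_Node by simp
  have "count_list w x \<noteq> 0" using cont bst by simp
  then obtain y w' where w: "w = y # w'" by (cases w) auto
  have "y \<in> letters \<langle>l, k, r\<rangle>"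
  proof (rule ccontr)
    assume "y \<notin> letters \<langle>l, k, r\<rangle>"
    then have "count_list w y = 0" using Node.prems(2) cont_notin by metis
    then show False using w by simp
  qed
  \<comment> \<open>Nothing precedes the first letter, so it cannot lie below the root.\<close>
  moreover have "\<not> ancestor \<langle>l, k, r\<rangle> x y"
    using Node.prems(3) unfolding w first_occs_ok_def by fastforce
  ultimately have y: "y = x" by auto
  have "fold insert_bstm (filter (\<lambda>a. a < x) w') \<langle>\<rangle> = l"
  proof (rule Node.IH(1)[OF bst(1)])
    show "count_list (filter (\<lambda>a. a < x) w') a = cont l a" for a
      using cont[of a] bst cont_notin[of a l] by (auto simp: count_list_filter w y)
    show "first_occs_ok l (filter (\<lambda>a. a < x) w')"
      by (rule first_occs_ok_filter[of "\<langle>l, k, r\<rangle>" x])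
        (use Node.prems w y bst in \<open>auto dest: ancestor_letters\<close>)
  qed
  moreover have "fold insert_bstm (filter (\<lambda>a. x < a) w') \<langle>\<rangle> = r"
  proof (rule Node.IH(2)[OF bst(2)])
    show "count_list (filter (\<lambda>a. x < a) w') a = cont r a" for a
      using cont[of a] bst cont_notin[of a r] by (auto simp: count_list_filter w y)
    show "first_occs_ok r (filter (\<lambda>a. x < a) w')"
      by (rule first_occs_ok_filter[of "\<langle>l, k, r\<rangle>" x])
        (use Node.prems w y bst in \<open>auto dest: ancestor_letters\<close>)
  qed
  moreover have "1 + count_list w' x = m"
    using cont[of x] by (simp add: w y)
  ultimately show ?case
    by (simp add: w y fold_insert_bstm_Node)
qed

subsection \<open>Twin trees\<close>

lemma inorder_nodes_nth:
  assumes "i < size T"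
  shows "value (inorder_nodes T ! i) = inorder T ! i" "inorder_nodes T ! i \<in> set (inorder_nodes T)"
proof -
  have "length (inorder_nodes T) = size T"
    by (metis length_inorder length_map map_value_inorder_nodes)
  with assms show "value (inorder_nodes T ! i) = inorder T ! i"
    "inorder_nodes T ! i \<in> set (inorder_nodes T)"
    by (metis map_value_inorder_nodes nth_map, simp)
qed

text \<open>Translates an ancestor pair into the indexed form of the twin condition; the side of the
  descendant tells which child must exist.\<close>

lemma ancestor_nthE:
  assumes "key_bst T" "ancestor T a b"
  obtains i l m r where "i < size T" "inorder_nodes T ! i = \<langle>l, (a, m), r\<rangle>"
    "map fst (inorder T) ! i = a" "(a, m) \<in> set_tree T"
    "b < a \<Longrightarrow> has_left_child \<langle>l, (a, m), r\<rangle>" "a < b \<Longrightarrow> has_right_child \<langle>l, (a, m), r\<rangle>"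
proof -
  have len: "length (inorder_nodes T) = size T"
    by (metis length_inorder length_map map_value_inorder_nodes)
  obtain l m r where n: "\<langle>l, (a, m), r\<rangle> \<in> set (inorder_nodes T)" "b \<in> letters l \<union> letters r"
    using assms by (auto simp: ancestor_iff_inorder_nodes)
  moreover have "key_bst t" if "t \<in> set (inorder_nodes T)" for t
    using assms(1) that by (induction T rule: inorder_nodes.induct) auto
  ultimately have bst: "key_bst \<langle>l, (a, m), r\<rangle>" by blast
  obtain i where i: "i < size T" "inorder_nodes T ! i = \<langle>l, (a, m), r\<rangle>"
    using n len by (metis in_set_conv_nth)
  then have v: "inorder T ! i = (a, m)"
    using inorder_nodes_nth(1) by fastforce
  have "map fst (inorder T) ! i = a" "(a, m) \<in> set_tree T"
    using v i(1) by (simp, metis length_inorder nth_mem set_inorder)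
  moreover have "l \<noteq> \<langle>\<rangle>" if "b < a"
    using n(2) bst that by force
  moreover have "r \<noteq> \<langle>\<rangle>" if "a < b"
    using n(2) bst that by force
  ultimately show ?thesis
    using that i by (simp add: has_left_child_def has_right_child_def)
qed

lemma twin_letters:
  assumes "twin_bstms T\<^sub>L T\<^sub>R"
  shows "letters T\<^sub>L = letters T\<^sub>R"
  using assms cont_pos_iff unfolding twin_bstms_def by (metis subsetI subset_antisym)

text \<open>The node labelled \<open>a\<close> has the same inorder index in both trees. As its
  multiplicity is 1, neither side may carry a child in both trees.\<close>

lemma twin_opposite_sides:
  assumes twin: "twin_bstms T\<^sub>L T\<^sub>R" and a: "cont T\<^sub>L a = 1"
    and L: "ancestor T\<^sub>L a b" and R: "ancestor T\<^sub>R a c"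
  shows "b < a \<longleftrightarrow> a < c"
proof -
  have bst: "key_bst T\<^sub>L" "key_bst T\<^sub>R"
    using twin by (simp_all add: twin_bstms_def bstm_key_bst)
  \<comment> \<open>Both inorders list the same set of letters increasingly, so equal letters sit at
    equal indices.\<close>
  have eq: "map fst (inorder T\<^sub>L) = map fst (inorder T\<^sub>R)"
    using bst twin_letters[OF twin]
    by (intro strict_sorted_equal) (simp_all add: key_bst_iff_sorted letters_eq_set_inorder)
  obtain i l m r where i: "i < size T\<^sub>L" "inorder_nodes T\<^sub>L ! i = \<langle>l, (a, m), r\<rangle>"
    "map fst (inorder T\<^sub>L) ! i = a" "(a, m) \<in> set_tree T\<^sub>L"
    "b < a \<Longrightarrow> has_left_child \<langle>l, (a, m), r\<rangle>" "a < b \<Longrightarrow> has_right_child \<langle>l, (a, m), r\<rangle>"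
    using ancestor_nthE[OF bst(1) L] by metis
  obtain j l' m' r' where j: "j < size T\<^sub>R" "inorder_nodes T\<^sub>R ! j = \<langle>l', (a, m'), r'\<rangle>"
    "map fst (inorder T\<^sub>R) ! j = a"
    "c < a \<Longrightarrow> has_left_child \<langle>l', (a, m'), r'\<rangle>" "a < c \<Longrightarrow> has_right_child \<langle>l', (a, m'), r'\<rangle>"
    using ancestor_nthE[OF bst(2) R] by metis
  have "size T\<^sub>L = size T\<^sub>R"
    using eq by (metis length_inorder length_map)
  then have "i = j"
    using i(1,3) j(1,3) eq nth_eq_iff_index_eq[OF key_bst_iff_distinct[OF bst(2)], of i j]
    by (simp del: nth_map)
  moreover have "m = 1" using cont_eq[OF bst(1) i(4)] a by simp
  moreover have "b \<noteq> a" "c \<noteq> a" using ancestor_irrefl bst L R by blast+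
  moreover have "\<not> (has_left_child \<langle>l, (a, m), r\<rangle> \<and> has_left_child \<langle>l', (a, m'), r'\<rangle>) \<and>
      \<not> (has_right_child \<langle>l, (a, m), r\<rangle> \<and> has_right_child \<langle>l', (a, m'), r'\<rangle>)"
    using twin i(1,2) j(2) \<open>i = j\<close> \<open>m = 1\<close> unfolding twin_bstms_def
    by (auto simp: Let_def node_mult_def)
  ultimately show ?thesis
    using i(5,6) j(4,5) by (meson linorder_neqE_nat)
qed

subsection \<open>Forests\<close>

text \<open>Inorder reading of the whole forest. The algorithm ignores the order of the trees, but
  putting the subtrees in place of a removed root keeps this list sorted.\<close>

definition keys :: "forest \<Rightarrow> nat list" where
  "keys F = concat (map (\<lambda>t. map fst (inorder t)) F)"

lemma keys_simps [simp]:
  "keys [] = []" "keys (t # F) = map fst (inorder t) @ keys F" "keys (F @ F') = keys F @ keys F'"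
  by (simp_all add: keys_def)

lemma set_keys: "set (keys F) = forest_letters F"
  by (auto simp: keys_def forest_letters_def letters_def)

lemma keys_forest_of: "keys (forest_of ts) = keys ts"
  by (induction ts) (auto simp: forest_of_def)

definition key :: "mtree \<Rightarrow> nat" where
  "key t = fst (value t)"

lemma key_Node [simp]: "key \<langle>l, (a, m), r\<rangle> = a"
  by (simp add: key_def)

lemma mtree_NodeE:
  fixes t :: mtree
  assumes "t \<noteq> \<langle>\<rangle>"
  obtains l a m r where "t = \<langle>l, (a, m), r\<rangle>"
  using assms by (metis neq_Leaf_iff surj_pair)

lemma key_in_letters: "t \<noteq> \<langle>\<rangle> \<Longrightarrow> key t \<in> letters t"
  by (cases t) auto

lemma ancestor_key: "b \<in> letters t \<Longrightarrow> b \<noteq> key t \<Longrightarrow> ancestor t (key t) b"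
  by (cases t) auto

text \<open>The condition on ancestors says that every tree contains all descendants of its nodes in \<open>T\<close>.\<close>

definition subforest :: "mtree \<Rightarrow> forest \<Rightarrow> bool" where
  "subforest T F \<longleftrightarrow> sorted_wrt (<) (keys F) \<and>
     (\<forall>t\<in>set F. t \<noteq> \<langle>\<rangle> \<and> set_tree t \<subseteq> set_tree T \<and>
        (\<forall>a\<in>letters t. \<forall>b. ancestor t a b \<longleftrightarrow> ancestor T a b))"

lemma subforest_key_bst: "subforest T F \<Longrightarrow> t \<in> set F \<Longrightarrow> key_bst t"
proof -
  assume "subforest T F" "t \<in> set F"
  then obtain A B where "sorted_wrt (<) (keys (A @ t # B))"
    unfolding subforest_def by (metis split_list)
  then show ?thesis by (simp add: key_bst_iff_sorted sorted_wrt_append)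
qed

lemma subforest_split:
  assumes "subforest T (A @ t # B)" "a \<in> letters t" "b \<in> letters t'"
  shows "t' \<in> set A \<Longrightarrow> b < a" "t' \<in> set B \<Longrightarrow> a < b"
proof -
  have "a \<in> set (map fst (inorder t))" using assms(2) letters_eq_set_inorder by blast
  then have "\<forall>c\<in>set (keys A). c < a" "\<forall>c\<in>set (keys B). a < c"
    using assms(1) by (auto simp: subforest_def sorted_wrt_append simp del: set_map)
  then show "t' \<in> set A \<Longrightarrow> b < a" "t' \<in> set B \<Longrightarrow> a < b"
    using assms(3) by (auto simp: set_keys forest_letters_def)
qed

text \<open>Sortedness of \<open>keys\<close> makes the trees occupy disjoint intervals in list
  order, and comparing the roots tells which tree comes first.\<close>

lemma subforest_separated:
  assumes "subforest T F" "t \<in> set F" "t' \<in> set F" "key t < key t'" "a \<in> letters t" "b \<in> letters t'"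
  shows "a < b"
proof -
  obtain A B where F: "F = A @ t # B" using assms(2) split_list by fast
  have ne: "t \<noteq> \<langle>\<rangle>" "t' \<noteq> \<langle>\<rangle>" using assms(1-3) by (auto simp: subforest_def)
  note split = subforest_split[OF assms(1)[unfolded F]]
  have "t' \<notin> set A"
    using split(1)[OF key_in_letters[OF ne(1)] key_in_letters[OF ne(2)]] assms(4) by fastforce
  then have "t' \<in> set B" using assms(3,4) F by auto
  then show ?thesis using split(2)[OF assms(5,6)] by blast
qed

lemma subforest_disjoint:
  assumes "subforest T F" "t \<in> set F" "t' \<in> set F" "a \<in> letters t" "a \<in> letters t'"
  shows "t = t'"
proof (rule ccontr)
  assume "t \<noteq> t'"
  obtain A B where F: "F = A @ t # B" using assms(2) split_list by fast
  have "t' \<in> set A \<or> t' \<in> set B" using assms(3) F \<open>t \<noteq> t'\<close> by auto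
  then show False
    using subforest_split[OF assms(1)[unfolded F] assms(4,5)] by auto
qed

text \<open>A tree of \<open>F\<close> containing such a \<open>c\<close> would contain
  \<open>key t\<close> too, hence be \<open>t\<close> itself, where nothing lies above the
  root.\<close>

lemma subforest_root_ancestor:
  assumes F: "subforest T F" and t: "t \<in> set F" and c: "ancestor T c (key t)"
  shows "c \<notin> forest_letters F"
proof
  assume "c \<in> forest_letters F"
  then obtain t' where t': "t' \<in> set F" "c \<in> letters t'" by (auto simp: forest_letters_def)
  then have anc: "ancestor t' c (key t)" using F c by (simp add: subforest_def)
  have "key t \<in> letters t" using F t by (simp add: subforest_def key_in_letters)
  then have "t' = t" using subforest_disjoint[OF F t'(1) t] ancestor_letters[OF anc] by blast
  moreover have bst: "key_bst t" using subforest_key_bst F t .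
  ultimately have "c \<noteq> key t" using anc ancestor_irrefl by blast
  then show False
    using ancestor_key t'(2) ancestor_asym[OF bst] anc \<open>t' = t\<close> by blast
qed

text \<open>Descendants of a node of \<open>l\<close> or \<open>r\<close> stay in that subtree, so
  both inherit the closure under descendants, and the list of keys only loses
  \<open>a\<close>.\<close>

lemma subforest_remove_root:
  assumes F: "subforest T (ts @ [\<langle>l, (a, m), r\<rangle>] @ ts')"
  shows "subforest T (ts @ forest_of [l, r] @ ts')"
    and "forest_letters (ts @ forest_of [l, r] @ ts') =
      forest_letters (ts @ [\<langle>l, (a, m), r\<rangle>] @ ts') - {a}"
proof -
  let ?t = "\<langle>l, (a, m), r\<rangle>"
  have bst: "key_bst ?t" using subforest_key_bst[OF F, of ?t] by simp
  have t: "set_tree ?t \<subseteq> set_tree T"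
    "\<And>x b. x \<in> letters ?t \<Longrightarrow> ancestor ?t x b \<longleftrightarrow> ancestor T x b"
    using F unfolding subforest_def by auto
  have lr: "letters l \<inter> letters r = {}" "a \<notin> letters l" "a \<notin> letters r"
    using bst by fastforce+
  have "ancestor l x b \<longleftrightarrow> ancestor T x b" if "x \<in> letters l" for x b
    using t(2)[of x b] that lr ancestor_letters[of r x b] by auto
  moreover have "ancestor r x b \<longleftrightarrow> ancestor T x b" if "x \<in> letters r" for x b
    using t(2)[of x b] that lr ancestor_letters[of l x b] by auto
  ultimately show "subforest T (ts @ forest_of [l, r] @ ts')"
    using F t(1) unfolding subforest_def keys_simps keys_forest_of
    by (auto simp: sorted_wrt_append forest_of_def)
  have "a \<notin> set (keys ts)" "a \<notin> set (keys ts')"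
    using F by (auto simp: subforest_def sorted_wrt_append)
  then show "forest_letters (ts @ forest_of [l, r] @ ts') =
      forest_letters (ts @ [?t] @ ts') - {a}"
    using lr unfolding set_keys[symmetric] keys_simps keys_forest_of
    by (auto simp flip: letters_eq_set_inorder simp del: set_map)
qed

subsection \<open>The invariant\<close>

text \<open>Mirror image of \<open>first_occs_ok\<close> for the reversed word. In use,
  \<open>S\<close> holds the letters whose last occurrence is still to be written and will supply
  the missing later occurrence.\<close>

definition last_occs_ok :: "mtree \<Rightarrow> nat set \<Rightarrow> word \<Rightarrow> bool" where
  "last_occs_ok T S w \<longleftrightarrow> (\<forall>a b p s. ancestor T a b \<and> w = p @ b # s \<longrightarrow> a \<in> set s \<union> S)"

lemma append_eq_append_Cons_cases:
  assumes "u @ [c] = p @ b # s"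
  obtains "s = []" "u = p" "c = b" | s' where "s = s' @ [c]" "u = p @ b # s'"
  using assms by (cases s rule: rev_cases) auto

lemma first_occs_ok_snoc:
  assumes "first_occs_ok T u" "\<And>c. ancestor T c b \<Longrightarrow> c \<in> set u"
  shows "first_occs_ok T (u @ [b])"
  unfolding first_occs_ok_def
proof (intro allI impI, elim conjE)
  fix a c p s assume a: "ancestor T a c" and "u @ [b] = p @ c # s"
  from this(2) show "a \<in> set p"
    by (cases rule: append_eq_append_Cons_cases)
      (use assms a in \<open>auto simp: first_occs_ok_def\<close>)
qed

lemma first_occs_ok_replicate:
  "first_occs_ok T u \<Longrightarrow> (\<And>c. ancestor T c b \<Longrightarrow> c \<in> set u) \<Longrightarrow>
     first_occs_ok T (u @ replicate n b)"
proof (induction n arbitrary: u)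
  case (Suc n)
  then have "first_occs_ok T ((u @ [b]) @ replicate n b)"
    by (intro Suc.IH first_occs_ok_snoc) auto
  then show ?case by simp
qed simp

text \<open>The letter \<open>b\<close> may leave the pending set because the copy appended now
  follows every earlier letter.\<close>

lemma last_occs_ok_snoc:
  assumes "last_occs_ok T S u" "\<And>c. ancestor T c b \<Longrightarrow> c \<in> S'" "S \<subseteq> insert b S'"
  shows "last_occs_ok T S' (u @ [b])"
  unfolding last_occs_ok_def
proof (intro allI impI, elim conjE)
  fix a c p s assume a: "ancestor T a c" and "u @ [b] = p @ c # s"
  from this(2) show "a \<in> set s \<union> S'"
  proof (cases rule: append_eq_append_Cons_cases)
    case 1
    then show ?thesis using a assms(2) by simp
  next
    case (2 s')
    then have "a \<in> set s' \<union> S" using assms(1) a unfolding last_occs_ok_def by blast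
    then show ?thesis using 2 assms(3) by auto
  qed
qed

lemma last_occs_ok_replicate:
  "last_occs_ok T S u \<Longrightarrow> (\<And>c. ancestor T c b \<Longrightarrow> c \<in> S) \<Longrightarrow>
     last_occs_ok T S (u @ replicate n b)"
proof (induction n arbitrary: u)
  case (Suc n)
  then have "last_occs_ok T S ((u @ [b]) @ replicate n b)"
    by (intro Suc.IH last_occs_ok_snoc[of T S]) auto
  then show ?case by simp
qed simp

lemma first_occs_ok_rev:
  assumes "last_occs_ok T {} u"
  shows "first_occs_ok T (rev u)"
  unfolding first_occs_ok_def
proof (intro allI impI, elim conjE)
  fix a b p s assume a: "ancestor T a b" and "rev u = p @ b # s"
  then have "u = rev s @ b # rev p"
    by (metis append.assoc append_Cons append_Nil rev.simps(2) rev_append rev_rev_ident)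
  then show "a \<in> set p" using assms a unfolding last_occs_ok_def by fastforce
qed

lemma count_list_replicate: "count_list (replicate n a) b = (if a = b then n else 0)"
  by (induction n) auto

locale twin_trees =
  fixes T\<^sub>L T\<^sub>R :: mtree
  assumes twin: "twin_bstms T\<^sub>L T\<^sub>R"
begin

lemma bstm_L: "bstm T\<^sub>L" and bstm_R: "bstm T\<^sub>R" and cont_LR: "cont T\<^sub>R = cont T\<^sub>L"
  using twin by (simp_all add: twin_bstms_def)

lemmas bst_L = bstm_key_bst[OF bstm_L] and bst_R = bstm_key_bst[OF bstm_R]

text \<open>A letter of \<open>U\<close> that has left the forest \<open>F\<close> still has exactly its last occurrence to be
  written; only letters of multiplicity greater than 1 can be in this situation.\<close>

definition invariant :: "word \<Rightarrow> forest \<Rightarrow> mtree \<Rightarrow> bool" where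
  "invariant u F U \<longleftrightarrow>
     subforest T\<^sub>L F \<and> key_bst U \<and> letters U \<subseteq> letters T\<^sub>L \<and>
     (\<forall>a b. ancestor U a b \<longleftrightarrow> ancestor T\<^sub>R a b \<and> b \<in> letters U) \<and>
     forest_letters F \<subseteq> letters U \<and>
     (\<forall>a. count_list u a = (if a \<in> forest_letters F then 0
        else if a \<in> letters U then cont T\<^sub>L a - 1 else cont T\<^sub>L a)) \<and>
     (\<forall>a\<in>letters U - forest_letters F. 1 < cont T\<^sub>L a) \<and>
     first_occs_ok T\<^sub>L u \<and> last_occs_ok T\<^sub>R (letters U) u"

lemma invariant_init: "invariant [] (forest_of [T\<^sub>L]) T\<^sub>R"
proof -
  have "forest_letters (forest_of [T\<^sub>L]) = letters T\<^sub>L"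
    by (auto simp: forest_letters_def forest_of_def)
  moreover have "subforest T\<^sub>L (forest_of [T\<^sub>L])"
    using bst_L by (auto simp: subforest_def forest_of_def key_bst_iff_sorted)
  moreover have "letters T\<^sub>R = letters T\<^sub>L"
    using twin_letters[OF twin] by simp
  ultimately show ?thesis
    using bst_R cont_notin[of _ T\<^sub>L]
    by (auto simp: invariant_def first_occs_ok_def last_occs_ok_def dest: ancestor_letters)
qed

lemma invariant_subforest: "invariant u F U \<Longrightarrow> subforest T\<^sub>L F"
  by (simp add: invariant_def)

text \<open>Outside the forest the count is the multiplicity, or one less for letters still in
  \<open>U\<close>; it stays positive because the latter have multiplicity above 1.\<close>

lemma invariant_written:
  assumes "invariant u F U" "a \<in> letters T\<^sub>L" "a \<notin> forest_letters F"
  shows "a \<in> set u"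
proof -
  have "0 < cont T\<^sub>L a" using assms(2) cont_pos_iff[OF bstm_L] by simp
  then have "0 < count_list u a" using assms unfolding invariant_def by force
  then show ?thesis by (metis count_list_0_iff less_irrefl)
qed

lemma invariant_root_ancestor:
  assumes inv: "invariant u F U" and "t \<in> set F" "ancestor T\<^sub>L c (key t)"
  shows "c \<in> set u"
proof (rule invariant_written[OF inv])
  show "c \<in> letters T\<^sub>L" using ancestor_letters assms(3) by blast
  show "c \<notin> forest_letters F"
    using subforest_root_ancestor invariant_subforest[OF inv] assms(2,3) by blast
qed

lemma invariant_cont_root:
  assumes "invariant u (ts @ [\<langle>l, (a, m), r\<rangle>] @ ts') U"
  shows "cont T\<^sub>L a = m"
  using assms bst_L by (intro cont_eq) (auto simp: invariant_def subforest_def)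

text \<open>The letter \<open>a\<close> leaves the forest but stays in \<open>U\<close>, so all
  copies except the last are due. Its ancestors in \<open>T\<^sub>R\<close> are still in
  \<open>U\<close> and hence pending.\<close>

lemma invariant_multiple:
  assumes inv: "invariant u (ts @ [\<langle>l, (a, m), r\<rangle>] @ ts') U" and m: "1 < m"
  shows "invariant (u @ replicate (m - 1) a) (ts @ forest_of [l, r] @ ts') U"
proof -
  let ?F = "ts @ [\<langle>l, (a, m), r\<rangle>] @ ts'" and ?F' = "ts @ forest_of [l, r] @ ts'"
  note F' = subforest_remove_root[OF invariant_subforest[OF inv]]
  have a: "a \<in> forest_letters ?F" by (simp add: forest_letters_def)
  then have aU: "a \<in> letters U" using inv by (auto simp: invariant_def)
  have cont: "cont T\<^sub>L a = m" using invariant_cont_root[OF inv] .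
  have first: "first_occs_ok T\<^sub>L (u @ replicate (m - 1) a)"
    using inv invariant_root_ancestor[OF inv, of "\<langle>l, (a, m), r\<rangle>"]
    by (intro first_occs_ok_replicate) (auto simp: invariant_def)
  have "c \<in> letters U" if "ancestor T\<^sub>R c a" for c
    using inv that aU ancestor_letters unfolding invariant_def by blast
  then have "last_occs_ok T\<^sub>R (letters U) (u @ replicate (m - 1) a)"
    using inv by (intro last_occs_ok_replicate) (auto simp: invariant_def)
  moreover have "count_list (u @ replicate (m - 1) a) b = (if b \<in> forest_letters ?F' then 0
      else if b \<in> letters U then cont T\<^sub>L b - 1 else cont T\<^sub>L b)" for b
    using inv a aU cont unfolding invariant_def F'(2) count_list_append count_list_replicate by auto
  ultimately show ?thesis
    using inv first F'(1) m cont unfolding invariant_def F'(2) by auto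
qed

text \<open>The ancestor clause of the invariant makes \<open>U\<close> closed upwards in
  \<open>T\<^sub>R\<close>, so everything above the removed leaf is still pending.\<close>

lemma remove_leaf_ancestor:
  assumes inv: "invariant u F U" and a: "a \<in> leaf_letters U"
  shows "key_bst (remove_leaf a U)" "letters (remove_leaf a U) = letters U - {a}"
    "ancestor (remove_leaf a U) b c \<longleftrightarrow> ancestor T\<^sub>R b c \<and> c \<in> letters (remove_leaf a U)"
    "ancestor T\<^sub>R c a \<Longrightarrow> c \<in> letters U - {a}"
proof -
  have U: "key_bst U" "\<And>b c. ancestor U b c \<longleftrightarrow> ancestor T\<^sub>R b c \<and> c \<in> letters U"
    using inv by (simp_all add: invariant_def)
  show "key_bst (remove_leaf a U)" "letters (remove_leaf a U) = letters U - {a}"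
    using U(1) a by (simp_all add: key_bst_remove_leaf letters_remove_leaf)
  show "ancestor (remove_leaf a U) b c \<longleftrightarrow> ancestor T\<^sub>R b c \<and> c \<in> letters (remove_leaf a U)"
    using U a by (auto simp: ancestor_remove_leaf letters_remove_leaf)
  show "ancestor T\<^sub>R c a \<Longrightarrow> c \<in> letters U - {a}"
    using U a leaf_letters_subset[of U] ancestor_letters[of U c a] ancestor_irrefl[OF bst_R] by blast
qed

text \<open>With multiplicity 1 the occurrence written is both first and last: the ancestors in
  \<open>T\<^sub>L\<close> are already written and those in \<open>T\<^sub>R\<close> are still
  pending.\<close>

lemma invariant_simple:
  assumes inv: "invariant u (ts @ [\<langle>l, (a, m), r\<rangle>] @ ts') U"
    and m: "\<not> 1 < m" and a: "a \<in> leaf_letters U"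
  shows "invariant (u @ [a]) (ts @ forest_of [l, r] @ ts') (remove_leaf a U)"
proof -
  let ?F = "ts @ [\<langle>l, (a, m), r\<rangle>] @ ts'" and ?F' = "ts @ forest_of [l, r] @ ts'"
  note U' = remove_leaf_ancestor[OF inv a]
  note F' = subforest_remove_root[OF invariant_subforest[OF inv]]
  have aF: "a \<in> forest_letters ?F" by (simp add: forest_letters_def)
  have aU: "a \<in> letters U" using a leaf_letters_subset by blast
  then have "0 < cont T\<^sub>L a" using inv cont_pos_iff[OF bstm_L] by (auto simp: invariant_def)
  then have cont: "cont T\<^sub>L a = 1" using invariant_cont_root[OF inv] m by simp
  have first: "first_occs_ok T\<^sub>L (u @ [a])"
    using inv invariant_root_ancestor[OF inv, of "\<langle>l, (a, m), r\<rangle>"]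
    by (intro first_occs_ok_snoc) (auto simp: invariant_def)
  have last: "last_occs_ok T\<^sub>R (letters U - {a}) (u @ [a])"
    using inv U'(4) by (intro last_occs_ok_snoc[of _ "letters U"]) (auto simp: invariant_def)
  have "count_list (u @ [a]) b = (if b \<in> forest_letters ?F - {a} then 0
      else if b \<in> letters U - {a} then cont T\<^sub>L b - 1 else cont T\<^sub>L b)" for b
    using inv aF aU cont unfolding invariant_def count_list_append by auto
  then show ?thesis
    using inv first last F'(1) U'(1,3) unfolding invariant_def F'(2) U'(2) by auto
qed

lemma invariant_last_occurrence:
  assumes inv: "invariant u F U" and a: "a \<in> leaf_letters U" "a \<notin> forest_letters F"
  shows "invariant (u @ [a]) F (remove_leaf a U)"
proof -
  note U' = remove_leaf_ancestor[OF inv a(1)]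
  have aU: "a \<in> letters U" using a leaf_letters_subset by blast
  then have "a \<in> set u" using invariant_written[OF inv _ a(2)] inv by (auto simp: invariant_def)
  \<comment> \<open>The earlier occurrence of \<open>a\<close> already has all ancestors of
    \<open>a\<close> in \<open>T\<^sub>L\<close> before it.\<close>
  then obtain p s where u: "u = p @ a # s" by (meson split_list)
  then have "c \<in> set p" if "ancestor T\<^sub>L c a" for c
    using inv that unfolding invariant_def first_occs_ok_def by blast
  then have "c \<in> set u" if "ancestor T\<^sub>L c a" for c
    using that u by simp
  then have first: "first_occs_ok T\<^sub>L (u @ [a])"
    using inv by (intro first_occs_ok_snoc) (auto simp: invariant_def)
  have last: "last_occs_ok T\<^sub>R (letters U - {a}) (u @ [a])"
    using inv U'(4) by (intro last_occs_ok_snoc[of _ "letters U"]) (auto simp: invariant_def)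
  have cont: "1 < cont T\<^sub>L a" using inv a aU by (auto simp: invariant_def)
  have "count_list u b = (if b \<in> forest_letters F then 0
      else if b \<in> letters U then cont T\<^sub>L b - 1 else cont T\<^sub>L b)" for b
    using inv by (simp add: invariant_def)
  then have "count_list (u @ [a]) b = (if b \<in> forest_letters F then 0
      else if b \<in> letters U - {a} then cont T\<^sub>L b - 1 else cont T\<^sub>L b)" for b
    using cont a(2) aU by (cases "b = a") (simp_all add: count_list_append)
  then show ?thesis
    using inv a first last U'(1,3) unfolding invariant_def U'(2) by auto
qed

lemma invariant_step:
  assumes "EmTg_step (u, F, U) (u', F', U')" "invariant u F U"
  shows "invariant u' F' U'"
  using assms
  by cases (auto intro: invariant_last_occurrence
      intro: invariant_multiple[simplified] invariant_simple[simplified])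

lemma invariant_reachable:
  assumes "EmTg_reachable T\<^sub>L T\<^sub>R (u, F, U)"
  shows "invariant u F U"
proof -
  have "EmTg_step\<^sup>*\<^sup>* (EmTg_init T\<^sub>L T\<^sub>R) s \<Longrightarrow> case s of (u, F, U) \<Rightarrow> invariant u F U" for s
    by (induction rule: rtranclp_induct)
      (auto simp: EmTg_init_def invariant_init intro: invariant_step)
  then show ?thesis using assms unfolding EmTg_reachable_def by fast
qed

text \<open>Nothing is pending any more, so the counts are exact and the order conditions hold
  outright, for \<open>u\<close> with \<open>T\<^sub>L\<close> and for \<open>rev u\<close> with
  \<open>T\<^sub>R\<close>.\<close>

lemma invariant_final:
  assumes "invariant u [] \<langle>\<rangle>"
  shows "u \<in> mTg_class T\<^sub>L T\<^sub>R"
proof -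
  have count: "\<And>a. count_list u a = cont T\<^sub>L a"
    using assms by (simp add: invariant_def forest_letters_def)
  have "1 \<le> a" if "a \<in> set u" for a
  proof -
    have "a \<in> letters T\<^sub>L"
      using that count[of a] cont_notin[of a T\<^sub>L] by (metis count_list_0_iff)
    then show ?thesis using bstm_L by (auto simp: letters_def bstm_def)
  qed
  moreover have "P_lTg u = T\<^sub>L"
    unfolding P_lTg_def using assms bstm_L count
    by (intro fold_insert_bstm_eq) (auto simp: invariant_def)
  moreover have "P_rTg u = T\<^sub>R"
    unfolding P_rTg_def using assms bstm_R count first_occs_ok_rev
    by (intro fold_insert_bstm_eq) (auto simp: invariant_def cont_LR)
  ultimately show ?thesis by (auto simp: mTg_class_def P_mTg_def)
qed

subsection \<open>Progress\<close>

text \<open>Suppose that no step is possible. Every root of \<open>F\<close> then has a leaf of \<open>U\<close> below it in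
  \<open>T\<^sub>R\<close>, on its left or on its right. The leftmost root has such a leaf on its right and the
  rightmost one does not, so there are neighbouring roots \<open>a < b\<close> where \<open>a\<close> has one on its right
  and \<open>b\<close> has one on its left. By the twin condition these leaves lie in trees of \<open>F\<close> beyond \<open>b\<close>
  and before \<open>a\<close>, respectively, so that \<open>a\<close> and \<open>b\<close> are ancestors of each other in \<open>T\<^sub>R\<close>.\<close>

lemma progress_root:
  assumes inv: "invariant u F U" and F: "F \<noteq> []"
    and leaves: "leaf_letters U \<subseteq> forest_letters F"
    and single: "\<And>t. t \<in> set F \<Longrightarrow> cont T\<^sub>L (key t) = 1"
  obtains t where "t \<in> set F" "key t \<in> leaf_letters U"
proof (rule ccontr)
  assume "\<not> thesis"
  then have no_leaf: "\<And>t. t \<in> set F \<Longrightarrow> key t \<notin> leaf_letters U" using that by blast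
  have sub: "subforest T\<^sub>L F" and U: "key_bst U" "letters U \<subseteq> letters T\<^sub>L" "forest_letters F \<subseteq> letters U"
    and anc: "\<And>a b. ancestor U a b \<longleftrightarrow> ancestor T\<^sub>R a b \<and> b \<in> letters U"
    using inv by (simp_all add: invariant_def)
  note sep = subforest_separated[OF sub]
  have key_in: "key t \<in> letters t" if "t \<in> set F" for t
    using that sub by (simp add: subforest_def key_in_letters)
  have key_TR: "key t \<in> letters T\<^sub>R" if "t \<in> set F" for t
    using key_in[OF that] that U twin_letters[OF twin] by (auto simp: forest_letters_def)
  have leaf_tree: "\<exists>t\<in>set F. y \<in> letters t" if "y \<in> leaf_letters U" for y
    using that leaves by (auto simp: forest_letters_def)
  have same_key: "t = t'" if "t \<in> set F" "t' \<in> set F" "key t = key t'" for t t'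
    using that subforest_disjoint[OF sub] key_in by metis
  \<comment> \<open>A leaf \<open>y\<close> of \<open>U\<close> inside \<open>t\<close> differs from
    the root, so it is a descendant of the root in \<open>T\<^sub>L\<close> as well and the twin
    condition applies.\<close>
  have opposite: "y < key t \<longleftrightarrow> key t < z"
    if "t \<in> set F" "y \<in> leaf_letters U" "y \<in> letters t" "ancestor T\<^sub>R (key t) z" for t y z
  proof -
    have "ancestor t (key t) y" using ancestor_key that no_leaf by metis
    then have "ancestor T\<^sub>L (key t) y" using sub that key_in by (auto simp: subforest_def)
    then show ?thesis using twin_opposite_sides twin single that by blast
  qed
  define Right where "Right t \<longleftrightarrow> (\<exists>y\<in>leaf_letters U. key t < y \<and> ancestor T\<^sub>R (key t) y)" for t
  define Left where "Left t \<longleftrightarrow> (\<exists>y\<in>leaf_letters U. y < key t \<and> ancestor T\<^sub>R (key t) y)" for t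
  have dir: "Right t \<or> Left t" if t: "t \<in> set F" for t
  proof -
    have "key t \<in> letters U" using t key_in U by (auto simp: forest_letters_def)
    then obtain y where y: "y \<in> leaf_letters U" "ancestor U (key t) y"
      using leaf_or_above_leaf[of "key t" U] no_leaf t by blast
    then have "ancestor T\<^sub>R (key t) y" using anc by simp
    moreover have "y < key t \<or> key t < y" using no_leaf[OF t] y(1) by (metis linorder_neqE_nat)
    ultimately show ?thesis using y(1) unfolding Right_def Left_def by blast
  qed
  have right_beyond: "\<exists>t'\<in>set F. key t < key t' \<and> y \<in> letters t'"
    if t: "t \<in> set F" "y \<in> leaf_letters U" "key t < y" "ancestor T\<^sub>R (key t) y" for t y
  proof -
    obtain t' where t': "t' \<in> set F" "y \<in> letters t'" using leaf_tree t by blast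
    \<comment> \<open>Otherwise \<open>opposite\<close>, applied to \<open>y\<close> in both roles,
      would equate \<open>y < key t\<close> with \<open>key t < y\<close>.\<close>
    have "t' \<noteq> t" using opposite t t' by fastforce
    moreover have "\<not> key t' < key t"
      using sep[OF t'(1) t(1) _ t'(2) key_in[OF t(1)]] t(3) by auto
    ultimately have "key t < key t'" using same_key t'(1) t(1) by (meson linorder_neqE_nat)
    then show ?thesis using t' by blast
  qed
  have left_beyond: "\<exists>t'\<in>set F. key t' < key t \<and> y \<in> letters t'"
    if t: "t \<in> set F" "y \<in> leaf_letters U" "y < key t" "ancestor T\<^sub>R (key t) y" for t y
  proof -
    obtain t' where t': "t' \<in> set F" "y \<in> letters t'" using leaf_tree t by blast
    have "t' \<noteq> t" using opposite t t' by fastforce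
    moreover have "\<not> key t < key t'"
      using sep[OF t(1) t'(1) _ key_in[OF t(1)] t'(2)] t(3) by auto
    ultimately have "key t' < key t" using same_key t'(1) t(1) by (meson linorder_neqE_nat)
    then show ?thesis using t' by blast
  qed
  \<comment> \<open>The least root has no leaf on its left, since \<open>left_beyond\<close> would
    yield a smaller root.\<close>
  have "\<exists>t\<in>set F. Right t"
  proof -
    obtain t where t: "t \<in> set F" "\<And>t'. t' \<in> set F \<Longrightarrow> key t \<le> key t'"
      using F arg_min_if_finite[of "set F" key] by (meson linorder_not_less list.set_finite set_empty)
    then show ?thesis using dir left_beyond unfolding Left_def by (meson linorder_not_less)
  qed
  \<comment> \<open>The greatest root with a leaf on its right becomes the left one of the two
    neighbouring roots.\<close>
  define K where "K = key ` {t \<in> set F. Right t}"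
  have "finite K" "K \<noteq> {}" using \<open>\<exists>t\<in>set F. Right t\<close> by (auto simp: K_def)
  then have "Max K \<in> K" "\<And>k. k \<in> K \<Longrightarrow> k \<le> Max K" by simp_all
  then obtain s where s: "s \<in> set F" "Right s" "\<And>t. t \<in> set F \<Longrightarrow> Right t \<Longrightarrow> key t \<le> key s"
    unfolding K_def by fastforce
  from s(2) obtain y where y: "y \<in> leaf_letters U" "key s < y" "ancestor T\<^sub>R (key s) y"
    unfolding Right_def by blast
  then obtain t\<^sub>y where ty: "t\<^sub>y \<in> set F" "key s < key t\<^sub>y" "y \<in> letters t\<^sub>y"
    using right_beyond s by blast
  \<comment> \<open>The next root after \<open>s\<close>, which exists because
    \<open>t\<^sub>y\<close> lies beyond \<open>s\<close>. By maximality of \<open>s\<close> it has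
    no leaf on its right, hence one on its left.\<close>
  then obtain t where t: "t \<in> set F" "key s < key t"
    "\<And>t'. t' \<in> set F \<Longrightarrow> key s < key t' \<Longrightarrow> key t \<le> key t'"
    using ex_has_least_nat[of "\<lambda>t. t \<in> set F \<and> key s < key t" t\<^sub>y key] by blast
  then have "Left t" using dir s(3) by (meson linorder_not_less)
  then obtain x where x: "x \<in> leaf_letters U" "x < key t" "ancestor T\<^sub>R (key t) x"
    unfolding Left_def by blast
  then obtain t\<^sub>x where tx: "t\<^sub>x \<in> set F" "key t\<^sub>x < key t" "x \<in> letters t\<^sub>x"
    using left_beyond t by blast
  \<comment> \<open>If \<open>y\<close> lies in \<open>t\<close> itself, the leaf \<open>x\<close>
    on the left of \<open>key t\<close> forces \<open>y\<close> to the right; otherwise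
    \<open>y\<close> lies in a tree after \<open>t\<close>.\<close>
  have "key t < y"
  proof (cases "t\<^sub>y = t")
    case True
    then show ?thesis
      using opposite[OF t(1) y(1) _ x(3)] ty(3) x(2) no_leaf[OF t(1)] y(1)
      by (metis linorder_neqE_nat order_less_asym)
  next
    case False
    then have "key t < key t\<^sub>y" using t(3)[OF ty(1,2)] same_key[OF ty(1) t(1)] by fastforce
    then show ?thesis using sep t(1) ty key_in by blast
  qed
  then have *: "ancestor T\<^sub>R (key s) (key t)"
    using ancestor_between[OF bst_R y(3) key_TR[OF t(1)]] t(2) by blast
  have "x < key s"
  proof (cases "t\<^sub>x = s")
    case True
    then show ?thesis
      using opposite[OF s(1) x(1) _ y(3)] tx(3) y(2) by simp
  next
    case False
    \<comment> \<open>No root lies strictly between \<open>s\<close> and \<open>t\<close>.\<close>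
    then have "key t\<^sub>x < key s"
      using t(3)[OF tx(1)] tx(2) same_key[OF tx(1) s(1)] by fastforce
    then show ?thesis using sep s(1) tx key_in by blast
  qed
  then have "ancestor T\<^sub>R (key t) (key s)"
    using ancestor_between[OF bst_R x(3) key_TR[OF s(1)]] t(2) by blast
  with * show False using ancestor_asym bst_R by blast
qed

text \<open>A leaf of \<open>U\<close> outside the forest enables the third rule. Otherwise the
  forest is nonempty, as a nonempty \<open>U\<close> has a leaf; a root of multiplicity above 1
  enables the first rule, and if there is none, \<open>progress_root\<close> enables the
  second.\<close>

lemma progress:
  assumes inv: "invariant u F U" and nonempty: "\<not> (F = [] \<and> U = \<langle>\<rangle>)"
  shows "\<exists>s. EmTg_step (u, F, U) s"
proof (cases "leaf_letters U \<subseteq> forest_letters F")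
  case False
  then show ?thesis using last_occurrence by blast
next
  case leaves: True
  have F: "F \<noteq> []"
    using leaves nonempty leaf_letters_nonempty[of U] by (auto simp: forest_letters_def)
  show ?thesis
  proof (cases "\<exists>l a m r. \<langle>l, (a, m), r\<rangle> \<in> set F \<and> 1 < m")
    case True
    then obtain ts l a m r ts' where "F = ts @ [\<langle>l, (a, m), r\<rangle>] @ ts'" "1 < m"
      by (metis append_Cons append_Nil split_list)
    then show ?thesis using multiple leaves by blast
  next
    case False
    have "cont T\<^sub>L (key t) = 1" if "t \<in> set F" for t
    proof -
      have "t \<noteq> \<langle>\<rangle>" and sub: "set_tree t \<subseteq> set_tree T\<^sub>L"
        using that invariant_subforest[OF inv] by (simp_all add: subforest_def)
      from this(1) obtain l a m r where t: "t = \<langle>l, (a, m), r\<rangle>" by (rule mtree_NodeE)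
      have "(a, m) \<in> set_tree T\<^sub>L" using t sub by auto
      moreover from this have "1 \<le> m" using bstm_L by (auto simp: bstm_def)
      moreover have "\<not> 1 < m" using False that t by blast
      ultimately show ?thesis using cont_eq[OF bst_L] t by fastforce
    qed
    then obtain t where t: "t \<in> set F" "key t \<in> leaf_letters U"
      using progress_root[OF inv F leaves] by blast
    then have "t \<noteq> \<langle>\<rangle>" using invariant_subforest[OF inv] by (simp add: subforest_def)
    then obtain l a m r where "t = \<langle>l, (a, m), r\<rangle>" by (rule mtree_NodeE)
    moreover from this have "\<not> 1 < m" using False t(1) by blast
    moreover obtain ts ts' where "F = ts @ [t] @ ts'"
      using t(1) by (metis append_Cons append_Nil split_list)
    ultimately show ?thesis using simple[of F ts l a m r ts' U] leaves t(2) by auto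
  qed
qed

end

section \<open>Termination and correctness\<close>

definition EmTg_size :: "EmTg_state \<Rightarrow> nat" where
  "EmTg_size = (\<lambda>(u, F, U). sum_list (map size F) + size U)"

lemma sum_list_size_forest_of: "sum_list (map size (forest_of ts)) = sum_list (map size ts)"
  by (induction ts) (auto simp: forest_of_def)

text \<open>Every rule deletes a node from the forest or from the right tree.\<close>

lemma EmTg_step_size: "EmTg_step s s' \<Longrightarrow> EmTg_size s' < EmTg_size s"
  by (induction rule: EmTg_step.induct)
    (use size_remove_leaf in \<open>fastforce simp: EmTg_size_def sum_list_size_forest_of\<close>)+

lemma EmTg_terminates: "\<not> EmTg_infinite_run T\<^sub>L T\<^sub>R run"
proof
  assume "EmTg_infinite_run T\<^sub>L T\<^sub>R run"
  then have "\<forall>i. (run (Suc i), run i) \<in> measure EmTg_size"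
    using EmTg_step_size by (simp add: EmTg_infinite_run_def)
  then show False using wf_measure[of EmTg_size] unfolding wf_iff_no_infinite_down_chain by blast
qed

text \<open>Together the three conjuncts cover every choice: each run is finite, it can only stop
  once both structures are empty, and the word returned then lies in the class.\<close>

theorem proposition4p20:
  fixes T\<^sub>L T\<^sub>R :: mtree
  assumes "twin_bstms T\<^sub>L T\<^sub>R"
  shows "(\<nexists>run. EmTg_infinite_run T\<^sub>L T\<^sub>R run) \<and>
    (\<forall>u U\<^sub>L U\<^sub>R. EmTg_reachable T\<^sub>L T\<^sub>R (u, U\<^sub>L, U\<^sub>R) \<and> \<not> (U\<^sub>L = [] \<and> U\<^sub>R = \<langle>\<rangle>) \<longrightarrow>
       (\<exists>s. EmTg_step (u, U\<^sub>L, U\<^sub>R) s)) \<and>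
    (\<forall>u. EmTg_returns T\<^sub>L T\<^sub>R u \<longrightarrow> u \<in> mTg_class T\<^sub>L T\<^sub>R)"
proof -
  interpret twin_trees T\<^sub>L T\<^sub>R
    using assms by unfold_locales
  show ?thesis
    using EmTg_terminates progress invariant_reachable invariant_final
    unfolding EmTg_returns_def by blast
qed

end
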